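(* Let $(Z_\alpha)$ and $(\epsilon_\alpha)$ be nets of normal integrands and non-negative (real) random variables, respectively, with $Z_\alpha,\epsilon_\alpha$ defined on a probability space $(\Omega_\alpha,\mathcal{A}_\alpha,\mathbb{P}_\alpha)$, and let $Z$ be a normal integrand and $\epsilon$ a non-negative (real) random variable on a probability space $(\Omega,\mathcal{A},\mathbb{P})$. Assume that $$(Z_\alpha,\epsilon_\alpha)\stackrel{\mathcal{D}}{\rightarrow}(Z,\epsilon)\quad\text{in }(S\times\mathbb{R}_+,\tau_e\times\mathcal{T}).$$ Then $A(Z_\alpha,\epsilon_\alpha)\stackrel{\mathcal{D}}{\rightarrow}A(Z,\epsilon)$ in $(\mathcal{F},\tau_{uF})$. This is the same as $$\limsup_\alpha\mathbb{P}_\alpha\Big(\bigcap_{K\in\mathcal{K}^*}\{\omega\in\Omega_\alpha:A(Z_\alpha(\omega),\epsilon_\alpha(\omega))\cap K\neq\emptyset\}\Big)\le\mathbb{P}\Big(\bigcap_{K\in\mathcal{K}^*}\{\omega\in\Omega:A(Z(\omega),\epsilon(\omega))\cap K\neq\emptyset\}\Big)$$ for every collection $\mathcal{K}^*\subseteq\mathcal{K}$ of compact sets in $E$.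
   Context: $(E,\mathcal{G})$ is a locally compact second countable Hausdorff space, $\mathcal{F}$ the family of its closed subsets, $\mathcal{K}$ the family of its compact subsets. $S$ is the set of all lower semicontinuous $f:E\to[-\infty,\infty]$; $I_A(f)=\inf_{x\in A}f(x)$ for $A\subseteq E$. The epi-topology $\tau_e$ is the coarsest topology on $S$ for which $I_K$ is lower semicontinuous for all $K\in\mathcal{K}$ and $I_G$ is upper semicontinuous for all $G\in\mathcal{G}$; $\mathcal{B}_e=\sigma(\tau_e)$. A normal integrand on a measurable space $(\Omega,\mathcal{A})$ is an $\mathcal{A}$–$\mathcal{B}_e$ measurable map $Z:\Omega\to S$. $\mathbb{R}_+=[0,\infty)$ and $\mathcal{T}=\{[0,r):0<r\in\mathbb{R}\}\cup\{\emptyset,\mathbb{R}_+\}$ is the left-order topology on $\mathbb{R}_+$; $\tau_e\times\mathcal{T}$ is the product topology. The upper Fell topology $\tau_{uF}$ on $\mathcal{F}$ is generated by the sets $\mathcal{M}(K)=\{F\in\mathcal{F}:F\cap K=\emptyset\}$, $K\in\mathcal{K}$. For $f\in S$, $\epsilon\ge0$: $A(f,\epsilon)=\{t\in E:f(t)\le I_E(f)+\epsilon\}\in\mathcal{F}$, the set of $\epsilon$-optimal solutions of $f$. Convergence in distribution $X_\alpha\stackrel{\mathcal{D}}{\rightarrow}X$ in a topological space $(\mathcal{X},\mathcal{O})$ of a net of random elements (measurable with respect to $\sigma(\mathcal{O})$, possibly defined on different probability spaces) means $\liminf_\alpha\mathbb{P}_\alpha(X_\alpha\in O)\ge\mathbb{P}(X\in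 O)$ for all $O\in\mathcal{O}$. *)

theory Defs
  imports "HOL-Probability.Probability"
begin

text \<open>
  A net is a family indexed by the elements of a set \<open>I\<close> that is directed by \<open>le\<close>. Limits
  inferior and superior along the net are the library's \<^const>\<open>Liminf\<close> and \<^const>\<open>Limsup\<close>
  for the filter generated by the tails \<open>{j \<in> I. le i j}\<close>.
\<close>

definition directed_set :: "'i set \<Rightarrow> ('i \<Rightarrow> 'i \<Rightarrow> bool) \<Rightarrow> bool" where
  "directed_set I le \<longleftrightarrow>
     I \<noteq> {} \<and> (\<forall>i\<in>I. le i i) \<and>
     (\<forall>i\<in>I. \<forall>j\<in>I. \<forall>k\<in>I. le i j \<longrightarrow> le j k \<longrightarrow> le i k) \<and>
     (\<forall>i\<in>I. \<forall>j\<in>I. \<exists>k\<in>I. le i k \<and> le j k)"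

definition net_filter :: "'i set \<Rightarrow> ('i \<Rightarrow> 'i \<Rightarrow> bool) \<Rightarrow> 'i filter" where
  "net_filter I le = (INF i\<in>I. principal {j\<in>I. le i j})"

lemma eventually_net_filter:
  assumes "directed_set I le"
  shows "eventually P (net_filter I le) \<longleftrightarrow> (\<exists>i\<in>I. \<forall>j\<in>I. le i j \<longrightarrow> P j)"
proof -
  have "eventually P (net_filter I le) \<longleftrightarrow>
      (\<exists>i\<in>I. eventually P (principal {j\<in>I. le i j}))"
    unfolding net_filter_def
  proof (rule eventually_INF_base)
    show "I \<noteq> {}"
      using assms by (simp add: directed_set_def)
    fix a b assume ab: "a \<in> I" "b \<in> I"
    then obtain k where k: "k \<in> I" "le a k" "le b k"
      using assms unfolding directed_set_def by meson
    have trans: "le x z" if "x \<in> I" "y \<in> I" "z \<in> I" "le x y" "le y z" for x y z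
      using assms that unfolding directed_set_def by meson
    have "{j \<in> I. le k j} \<subseteq> {j \<in> I. le a j} \<inter> {j \<in> I. le b j}"
      using trans[OF ab(1) k(1) _ k(2)] trans[OF ab(2) k(1) _ k(3)] by blast
    then show "\<exists>x\<in>I. principal {j \<in> I. le x j}
        \<le> inf (principal {j \<in> I. le a j}) (principal {j \<in> I. le b j})"
      using k(1) by (intro bexI[of _ k]) (simp_all only: inf_principal principal_le_iff)
  qed
  then show ?thesis
    by (auto simp: eventually_principal)
qed

definition borel_of :: "'x topology \<Rightarrow> 'x measure" where
  "borel_of X = sigma (topspace X) {U. openin X U}"

definition converges_in_distribution ::
  "'x topology \<Rightarrow> 'i set \<Rightarrow> ('i \<Rightarrow> 'i \<Rightarrow> bool) \<Rightarrow> ('i \<Rightarrow> 'w measure) \<Rightarrow> ('i \<Rightarrow> 'w \<Rightarrow> 'x)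
     \<Rightarrow> 'v measure \<Rightarrow> ('v \<Rightarrow> 'x) \<Rightarrow> bool" where
  "converges_in_distribution X I le P Y Q Y' \<longleftrightarrow>
     (\<forall>i\<in>I. Y i \<in> P i \<rightarrow>\<^sub>M borel_of X) \<and>
     Y' \<in> Q \<rightarrow>\<^sub>M borel_of X \<and>
     (\<forall>U. openin X U \<longrightarrow>
        Liminf (net_filter I le) (\<lambda>i. emeasure (P i) {\<omega> \<in> space (P i). Y i \<omega> \<in> U})
          \<ge> emeasure Q {\<omega> \<in> space Q. Y' \<omega> \<in> U})"

definition lower_semicontinuous_map :: "'x topology \<Rightarrow> ('x \<Rightarrow> ereal) \<Rightarrow> bool" where
  "lower_semicontinuous_map X f \<longleftrightarrow> (\<forall>c. openin X {x \<in> topspace X. f x > c})"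

definition upper_semicontinuous_map :: "'x topology \<Rightarrow> ('x \<Rightarrow> ereal) \<Rightarrow> bool" where
  "upper_semicontinuous_map X f \<longleftrightarrow> (\<forall>c. openin X {x \<in> topspace X. f x < c})"

text \<open>
  The space \<open>E\<close> is the carrier of an abstract topology, so functions on \<open>E\<close> are represented
  by HOL functions that are \<open>undefined\<close> off the carrier (\<^const>\<open>extensional\<close>). This makes
  equality of elements of \<open>lsc_functions E\<close> coincide with equality on \<open>E\<close>.
\<close>

definition lsc_functions :: "'a topology \<Rightarrow> ('a \<Rightarrow> ereal) set" where
  "lsc_functions E = {f \<in> extensional (topspace E). lower_semicontinuous_map E f}"

definition inf_on :: "'a set \<Rightarrow> ('a \<Rightarrow> ereal) \<Rightarrow> ereal" where
  "inf_on A f = (INF x\<in>A. f x)"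

definition epi_topology :: "'a topology \<Rightarrow> ('a \<Rightarrow> ereal) topology" where
  "epi_topology E = topology_generated_by
     ({{f \<in> lsc_functions E. inf_on K f > c} | K c. compactin E K} \<union>
      {{f \<in> lsc_functions E. inf_on G f < c} | G c. openin E G})"

lemma topspace_epi_topology [simp]: "topspace (epi_topology E) = lsc_functions E"
proof -
  have "lsc_functions E = {f \<in> lsc_functions E. inf_on {} f > 0}"
    by (auto simp: inf_on_def top_ereal_def)
  moreover have "compactin E {}"
    by simp
  ultimately have "lsc_functions E \<in> {{f \<in> lsc_functions E. inf_on K f > c} | K c. compactin E K}"
    by blast
  then show ?thesis
    unfolding epi_topology_def topology_generated_by_topspace by blast
qed

text \<open>
  The lemmas below show that this is the coarsest topology on the set of lower
  semicontinuous functions with the required semicontinuity of the infimum functionals.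
\<close>

lemma epi_topology_inf_compact:
  assumes "compactin E K"
  shows "lower_semicontinuous_map (epi_topology E) (inf_on K)"
  unfolding lower_semicontinuous_map_def topspace_epi_topology
proof
  fix c
  have "{f \<in> lsc_functions E. inf_on K f > c} \<in> {{f \<in> lsc_functions E. inf_on K f > c} | K c. compactin E K}"
    using assms by blast
  then show "openin (epi_topology E) {f \<in> lsc_functions E. inf_on K f > c}"
    unfolding epi_topology_def by (intro topology_generated_by_Basis UnI1)
qed

lemma epi_topology_inf_open:
  assumes "openin E G"
  shows "upper_semicontinuous_map (epi_topology E) (inf_on G)"
  unfolding upper_semicontinuous_map_def topspace_epi_topology
proof
  fix c
  have "{f \<in> lsc_functions E. inf_on G f < c} \<in> {{f \<in> lsc_functions E. inf_on G f < c} | G c. openin E G}"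
    using assms by blast
  then show "openin (epi_topology E) {f \<in> lsc_functions E. inf_on G f < c}"
    unfolding epi_topology_def by (intro topology_generated_by_Basis UnI2)
qed

lemma epi_topology_coarsest:
  assumes "topspace X = lsc_functions E"
    and "\<And>K. compactin E K \<Longrightarrow> lower_semicontinuous_map X (inf_on K)"
    and "\<And>G. openin E G \<Longrightarrow> upper_semicontinuous_map X (inf_on G)"
    and "openin (epi_topology E) U"
  shows "openin X U"
proof -
  have "generate_topology_on
     ({{f \<in> lsc_functions E. inf_on K f > c} | K c. compactin E K} \<union>
      {{f \<in> lsc_functions E. inf_on G f < c} | G c. openin E G}) U"
    using assms(4) unfolding epi_topology_def by (rule openin_topology_generated_by)
  then show ?thesis
  proof (rule generate_topology_on_coarsest[OF istopology_openin, rotated 1])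
    fix S
    assume "S \<in> {{f \<in> lsc_functions E. inf_on K f > c} | K c. compactin E K} \<union>
      {{f \<in> lsc_functions E. inf_on G f < c} | G c. openin E G}"
    then show "openin X S"
      using assms(1-3)
      unfolding lower_semicontinuous_map_def upper_semicontinuous_map_def by auto
  qed
qed

definition normal_integrand :: "'a topology \<Rightarrow> 'w measure \<Rightarrow> ('w \<Rightarrow> 'a \<Rightarrow> ereal) \<Rightarrow> bool" where
  "normal_integrand E M Z \<longleftrightarrow> Z \<in> M \<rightarrow>\<^sub>M borel_of (epi_topology E)"

definition left_order_topology :: "real topology" where
  "left_order_topology =
     topology (\<lambda>U. U \<in> {{0..<r} | r. 0 < r} \<union> {{}, {0..}})"

lemma istopology_left_order:
  "istopology (\<lambda>U::real set. U \<in> {{0..<r} | r. 0 < r} \<union> {{}, {0..}})"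
proof -
  define T :: "real set set" where "T = {{0..<r} | r. 0 < r} \<union> {{}, {0..}}"
  have T_iff: "U \<in> T \<longleftrightarrow> U \<subseteq> {0..} \<and> (\<forall>x\<in>U. \<forall>y. 0 \<le> y \<longrightarrow> y \<le> x \<longrightarrow> y \<in> U) \<and>
      (\<forall>x\<in>U. \<exists>y\<in>U. x < y)" for U
  proof
    assume "U \<in> T"
    then consider r where "0 < r" "U = {0..<r}" | "U = {}" | "U = {0..}"
      unfolding T_def by blast
    then show "U \<subseteq> {0..} \<and> (\<forall>x\<in>U. \<forall>y. 0 \<le> y \<longrightarrow> y \<le> x \<longrightarrow> y \<in> U) \<and> (\<forall>x\<in>U. \<exists>y\<in>U. x < y)"
    proof cases
      case 1
      have "\<exists>y\<in>U. x < y" if "x \<in> U" for x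
        using that 1 by (intro bexI[of _ "(x + r) / 2"]) simp_all
      with 1 show ?thesis by auto
    next
      case 3
      have "\<exists>y\<in>U. x < y" if "x \<in> U" for x
        using that 3 by (intro bexI[of _ "x + 1"]) simp_all
      with 3 show ?thesis by simp
    qed simp_all
  next
    assume U: "U \<subseteq> {0..} \<and> (\<forall>x\<in>U. \<forall>y. 0 \<le> y \<longrightarrow> y \<le> x \<longrightarrow> y \<in> U) \<and> (\<forall>x\<in>U. \<exists>y\<in>U. x < y)"
    show "U \<in> T"
    proof (cases "U = {} \<or> U = {0..}")
      case True
      then show ?thesis unfolding T_def by blast
    next
      case False
      then obtain a b where a: "a \<in> U" and b: "0 \<le> b" "b \<notin> U"
        using U by auto
      have ub: "x \<le> b" if "x \<in> U" for x
        using U that b by (meson linear)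
      have bdd: "bdd_above U"
        using ub by (auto simp: bdd_above_def)
      have less: "x < Sup U" if "x \<in> U" for x
        using U that bdd by (meson cSup_upper less_le_trans)
      have "U = {0..<Sup U}"
      proof (intro equalityI subsetI)
        fix x assume "x \<in> U"
        then show "x \<in> {0..<Sup U}" using U less by auto
      next
        fix x assume x: "x \<in> {0..<Sup U}"
        then obtain y where "y \<in> U" "x < y"
          using a bdd less_cSup_iff[of U x] by auto
        then show "x \<in> U" using U x by auto
      qed
      moreover have "0 < Sup U"
        using less[OF a] U a by force
      ultimately show ?thesis unfolding T_def by blast
    qed
  qed
  have "istopology (\<lambda>U. U \<in> T)"
    unfolding istopology_def
  proof (intro conjI allI impI)
    fix U V assume UV: "U \<in> T" "V \<in> T"
    have "\<exists>y\<in>U \<inter> V. x < y" if "x \<in> U \<inter> V" for x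
    proof -
      have "\<exists>u\<in>U. x < u" "\<exists>v\<in>V. x < v" "0 \<le> x"
        using UV that unfolding T_iff by auto
      then obtain u v where uv: "u \<in> U" "x < u" "v \<in> V" "x < v" "0 \<le> x"
        by blast
      have "min u v \<in> U"
        using UV(1) uv unfolding T_iff by (meson min.cobounded1 min_less_iff_conj order_less_imp_le order_trans)
      moreover have "min u v \<in> V"
        using UV(2) uv unfolding T_iff by (meson min.cobounded2 min_less_iff_conj order_less_imp_le order_trans)
      ultimately show ?thesis
        using uv by (intro bexI[of _ "min u v"]) simp_all
    qed
    moreover have "U \<inter> V \<subseteq> {0..}"
      using UV unfolding T_iff by auto
    moreover have "y \<in> U \<inter> V" if "x \<in> U \<inter> V" "0 \<le> y" "y \<le> x" for x y
      using UV that unfolding T_iff by auto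
    ultimately show "U \<inter> V \<in> T"
      unfolding T_iff[of "U \<inter> V"] by (intro conjI ballI allI impI)
  next
    fix \<K> assume K: "\<forall>K\<in>\<K>. K \<in> T"
    have "\<Union>\<K> \<subseteq> {0..}"
      using K T_iff by (intro Union_least) simp
    moreover have "y \<in> \<Union>\<K>" if x: "x \<in> \<Union>\<K>" and y: "0 \<le> y" "y \<le> x" for x y
    proof -
      obtain W where "W \<in> \<K>" "x \<in> W"
        using x by (rule UnionE)
      moreover from this have "y \<in> W"
        using K y T_iff[of W] by simp
      ultimately show ?thesis by (intro UnionI)
    qed
    moreover have "\<exists>y\<in>\<Union>\<K>. x < y" if x: "x \<in> \<Union>\<K>" for x
    proof -
      obtain W where W: "W \<in> \<K>" "x \<in> W"
        using x by (rule UnionE)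
      then obtain y where "y \<in> W" "x < y"
        using K T_iff[of W] by auto
      with W(1) show ?thesis by (intro bexI[of _ y] UnionI)
    qed
    ultimately show "\<Union>\<K> \<in> T"
      unfolding T_iff[of "\<Union>\<K>"] by (intro conjI ballI allI impI)
  qed
  then show ?thesis unfolding T_def .
qed

lemma openin_left_order_topology:
  "openin left_order_topology U \<longleftrightarrow> U \<in> {{0..<r} | r. 0 < r} \<union> {{}, {0..}}"
  unfolding left_order_topology_def
  by (subst topology_inverse'[OF istopology_left_order]) (rule refl)

lemma topspace_left_order_topology [simp]: "topspace left_order_topology = {0..}"
proof
  show "topspace left_order_topology \<subseteq> {0..}"
    unfolding topspace_def openin_left_order_topology by auto
  have "openin left_order_topology {0..}"
    unfolding openin_left_order_topology by blast
  then show "{0..} \<subseteq> topspace left_order_topology"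
    by (rule openin_subset)
qed

definition upper_Fell_topology :: "'a topology \<Rightarrow> 'a set topology" where
  "upper_Fell_topology E =
     topology_generated_by {{F. closedin E F \<and> F \<inter> K = {}} | K. compactin E K}"

lemma topspace_upper_Fell_topology [simp]:
  "topspace (upper_Fell_topology E) = {F. closedin E F}"
proof -
  have "compactin E {}"
    by simp
  then have "{F. closedin E F} \<in> {{F. closedin E F \<and> F \<inter> K = {}} | K. compactin E K}"
    by blast
  then show ?thesis
    unfolding upper_Fell_topology_def topology_generated_by_topspace by blast
qed

definition eps_optimal :: "'a topology \<Rightarrow> ('a \<Rightarrow> ereal) \<Rightarrow> real \<Rightarrow> 'a set" where
  "eps_optimal E f e = {t \<in> topspace E. f t \<le> inf_on (topspace E) f + ereal e}"

end

theory Submission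
  imports Defs
begin

text \<open>
  For a lower semicontinuous \<open>f\<close> and a nonempty compact \<open>K\<close> the infimum of \<open>f\<close> over \<open>K\<close>
  is attained, so the set of \<open>\<epsilon>\<close>-optimal solutions misses \<open>K\<close> exactly when
  \<open>I\<^sub>E(f) + \<epsilon> < I\<^sub>K(f)\<close> (\<open>eps_optimal_disjoint_iff\<close>). In this inequality the right-hand
  side depends lower semicontinuously on \<open>f\<close>, the left-hand side upper semicontinuously on
  \<open>(f, \<epsilon>)\<close>, where for \<open>\<epsilon>\<close> this refers to the left-order topology. Hence the strict
  inequality is an open condition, which says that \<open>(f, \<epsilon>) \<mapsto> A(f, \<epsilon>)\<close> is continuous into
  the upper Fell topology (\<open>continuous_map_eps_optimal\<close>). The first claim is then an instance
  of the continuous mapping principle (\<open>converges_in_distribution_continuous_map\<close>).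

  The inequality with compact sets is the portmanteau statement for complements. The sets
  \<open>\<M>(K)\<close> form a base of the upper Fell topology, since \<open>\<M>(K) \<inter> \<M>(L) = \<M>(K \<union> L)\<close>; so the
  complements of the open sets are exactly the sets of those \<open>F\<close> that hit every member of
  some family of compact sets, and an inequality for the limit inferior becomes one for the
  limit superior on passing to complementary probabilities. Complementation needs these events
  to be measurable, even though the family may be uncountable. Here the countable base of \<open>E\<close>
  enters: it yields countably many compact sets whose \<open>\<M>(L)\<close> already form a base
  (\<open>countable_compact_interpolation\<close>), so every event in question is the complement of a
  countable union of events \<open>A(Z, \<epsilon>) \<inter> L = {}\<close>, and those are described by the inequality
  above between measurable functions.
\<close>

section \<open>Probabilities of open sets along a net\<close>

lemma space_borel_of [simp]: "space (borel_of X) = topspace X"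
  unfolding borel_of_def by (rule space_measure_of) (auto dest: openin_subset)

lemma sets_borel_of: "sets (borel_of X) = sigma_sets (topspace X) {U. openin X U}"
  unfolding borel_of_def by (rule sets_measure_of) (auto dest: openin_subset)

lemma openin_imp_sets_borel_of: "openin X U \<Longrightarrow> U \<in> sets (borel_of X)"
  by (simp add: sets_borel_of sigma_sets.Basic)

lemma measurable_borel_ofI:
  assumes "\<And>\<omega>. \<omega> \<in> space M \<Longrightarrow> f \<omega> \<in> topspace X"
    and "\<And>U. openin X U \<Longrightarrow> {\<omega> \<in> space M. f \<omega> \<in> U} \<in> sets M"
  shows "f \<in> M \<rightarrow>\<^sub>M borel_of X"
proof (rule measurable_sigma_sets[OF sets_borel_of])
  show "f -` U \<inter> space M \<in> sets M" if "U \<in> {U. openin X U}" for U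
    using assms(2)[of U] that by (simp add: vimage_def Int_def conj_commute)
qed (use assms(1) in \<open>auto dest: openin_subset\<close>)

lemma measurable_borel_of_openin:
  assumes "f \<in> M \<rightarrow>\<^sub>M borel_of X" and "openin X U"
  shows "{\<omega> \<in> space M. f \<omega> \<in> U} \<in> sets M"
  using measurable_sets[OF assms(1) openin_imp_sets_borel_of[OF assms(2)]]
  by (simp add: vimage_def Int_def conj_commute)

lemma continuous_map_measurable_borel_of:
  assumes "continuous_map X Y g"
  shows "g \<in> borel_of X \<rightarrow>\<^sub>M borel_of Y"
proof (rule measurable_borel_ofI)
  show "g x \<in> topspace Y" if "x \<in> space (borel_of X)" for x
    using assms that by (auto simp: continuous_map_def)
  show "{x \<in> space (borel_of X). g x \<in> U} \<in> sets (borel_of X)" if "openin Y U" for U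
    using openin_continuous_map_preimage[OF assms that]
    by (simp add: openin_imp_sets_borel_of)
qed

lemma eventually_in_net_filter:
  assumes "directed_set I le"
  shows "eventually (\<lambda>i. i \<in> I) (net_filter I le)"
proof -
  obtain i where "i \<in> I"
    using assms unfolding directed_set_def by blast
  then show ?thesis
    unfolding eventually_net_filter[OF assms] by (intro bexI[of _ i]) simp_all
qed

lemma converges_in_distribution_continuous_map:
  assumes dir: "directed_set I le" and g: "continuous_map X Y g"
    and conv: "converges_in_distribution X I le P V Q V'"
  shows "converges_in_distribution Y I le P (\<lambda>i \<omega>. g (V i \<omega>)) Q (\<lambda>\<omega>. g (V' \<omega>))"
proof -
  have V: "V i \<in> P i \<rightarrow>\<^sub>M borel_of X" if "i \<in> I" for i
    using conv that by (simp add: converges_in_distribution_def)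
  have V': "V' \<in> Q \<rightarrow>\<^sub>M borel_of X"
    using conv by (simp add: converges_in_distribution_def)
  have lim: "\<forall>U. openin X U \<longrightarrow> emeasure Q {\<omega> \<in> space Q. V' \<omega> \<in> U}
      \<le> Liminf (net_filter I le) (\<lambda>i. emeasure (P i) {\<omega> \<in> space (P i). V i \<omega> \<in> U})"
    using conv by (simp add: converges_in_distribution_def)
  have "emeasure Q {\<omega> \<in> space Q. g (V' \<omega>) \<in> U}
      \<le> Liminf (net_filter I le) (\<lambda>i. emeasure (P i) {\<omega> \<in> space (P i). g (V i \<omega>) \<in> U})"
    if U: "openin Y U" for U
  proof -
    let ?W = "{x \<in> topspace X. g x \<in> U}"
    have "{\<omega> \<in> space Q. g (V' \<omega>) \<in> U} = {\<omega> \<in> space Q. V' \<omega> \<in> ?W}"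
      using measurable_space[OF V'] by auto
    also have "emeasure Q \<dots>
        \<le> Liminf (net_filter I le) (\<lambda>i. emeasure (P i) {\<omega> \<in> space (P i). V i \<omega> \<in> ?W})"
      using lim openin_continuous_map_preimage[OF g U] by blast
    also have "\<dots> = Liminf (net_filter I le) (\<lambda>i. emeasure (P i) {\<omega> \<in> space (P i). g (V i \<omega>) \<in> U})"
    proof (rule Liminf_eq)
      have "{\<omega> \<in> space (P i). V i \<omega> \<in> ?W} = {\<omega> \<in> space (P i). g (V i \<omega>) \<in> U}" if "i \<in> I" for i
        using measurable_space[OF V[OF that]] by auto
      then show "\<forall>\<^sub>F i in net_filter I le. emeasure (P i) {\<omega> \<in> space (P i). V i \<omega> \<in> ?W}
          = emeasure (P i) {\<omega> \<in> space (P i). g (V i \<omega>) \<in> U}"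
        using eventually_in_net_filter[OF dir] by (auto elim: eventually_mono)
    qed
    finally show ?thesis .
  qed
  then show ?thesis
    unfolding converges_in_distribution_def
    using measurable_compose[OF V continuous_map_measurable_borel_of[OF g]]
      measurable_compose[OF V' continuous_map_measurable_borel_of[OF g]]
    by simp
qed

lemma ennreal_complement_less_iff:
  fixes p u y :: ennreal
  assumes "p + u = 1" and "y \<le> 1"
  shows "1 - y < u \<longleftrightarrow> p < y"
  using assms
  by (cases p; cases u; cases y)
     (auto simp: top_unique ennreal_minus ennreal_less_iff ennreal_plus[symmetric] ennreal_1[symmetric]
        simp del: ennreal_plus ennreal_1)

text \<open>
  The order-reversing bijection \<open>y \<mapsto> 1 - y\<close> of the unit interval exchanges the thresholds
  that describe a limit inferior with those that describe a limit superior. Complementarity is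
  assumed only eventually: along a net the limits concern functions on the whole index type,
  whereas the measures are probabilities for indices in the directed set.
\<close>

lemma le_Liminf_complement_iff:
  fixes p u :: "'i \<Rightarrow> ennreal"
  assumes pu: "eventually (\<lambda>i. p i + u i = 1) F" and qv: "q + v = 1"
  shows "v \<le> Liminf F u \<longleftrightarrow> Limsup F p \<le> q"
proof
  assume L: "v \<le> Liminf F u"
  show "Limsup F p \<le> q"
    unfolding Limsup_le_iff
  proof (intro allI impI)
    fix y assume y: "q < y"
    show "eventually (\<lambda>i. p i < y) F"
    proof (cases "y \<le> 1")
      case True
      then have "1 - y < v"
        using y ennreal_complement_less_iff[OF qv] by blast
      then have "eventually (\<lambda>i. 1 - y < u i) F"
        using L unfolding le_Liminf_iff by blast
      with pu show ?thesis
        by eventually_elim (use True ennreal_complement_less_iff in blast)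
    next
      case False
      \<comment> \<open>The substitution \<open>1 - y\<close> truncates to \<open>0\<close> here, but no \<open>p i\<close> exceeds \<open>1\<close>.\<close>
      from pu show ?thesis
      proof eventually_elim
        case (elim i)
        then have "p i \<le> 1"
          using add_increasing2[of "u i" "p i" "p i"] by simp
        then show ?case
          using False by simp
      qed
    qed
  qed
next
  assume L: "Limsup F p \<le> q"
  show "v \<le> Liminf F u"
    unfolding le_Liminf_iff
  proof (intro allI impI)
    fix y assume y: "y < v"
    have "v \<le> 1"
      using qv add_increasing[of q v v] by simp
    with y have yy: "1 - (1 - y) = y"
      by (intro diff_diff_ennreal) auto
    have less: "y < u' \<longleftrightarrow> p' < 1 - y" if "p' + u' = 1" for p' u'
      using ennreal_complement_less_iff[OF that, of "1 - y"] unfolding yy by simp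
    have "eventually (\<lambda>i. p i < 1 - y) F"
      using L y less[OF qv] unfolding Limsup_le_iff by blast
    with pu show "eventually (\<lambda>i. y < u i) F"
      by eventually_elim (use less in blast)
  qed
qed

section \<open>Random closed sets and the upper Fell topology\<close>

text \<open>
  The sets \<open>\<M>(K)\<close> are not just a subbase but a base of the upper Fell topology, because
  missing \<open>K\<close> and \<open>L\<close> means missing the compact set \<open>K \<union> L\<close>.
\<close>

lemma openin_upper_Fell_iff:
  "openin (upper_Fell_topology E) U \<longleftrightarrow>
     (\<exists>\<K>. (\<forall>K\<in>\<K>. compactin E K) \<and> U = {F. closedin E F \<and> (\<exists>K\<in>\<K>. F \<inter> K = {})})"
  (is "_ \<longleftrightarrow> ?R U")
proof
  assume "openin (upper_Fell_topology E) U"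
  then have "generate_topology_on {{F. closedin E F \<and> F \<inter> K = {}} | K. compactin E K} U"
    unfolding upper_Fell_topology_def by (rule openin_topology_generated_by)
  then show "?R U"
  proof induction
    case Empty
    show ?case by (rule exI[of _ "{}"]) simp
  next
    case (Int A B)
    then obtain \<A> \<B> where *: "\<forall>K\<in>\<A>. compactin E K" "\<forall>K\<in>\<B>. compactin E K"
      "A = {F. closedin E F \<and> (\<exists>K\<in>\<A>. F \<inter> K = {})}"
      "B = {F. closedin E F \<and> (\<exists>K\<in>\<B>. F \<inter> K = {})}"
      by blast
    let ?\<N> = "(\<Union>K\<in>\<A>. (\<lambda>L. K \<union> L) ` \<B>)"
    have "(\<exists>N\<in>?\<N>. F \<inter> N = {}) \<longleftrightarrow> (\<exists>K\<in>\<A>. \<exists>L\<in>\<B>. F \<inter> K = {} \<and> F \<inter> L = {})" for F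
      by (simp add: Int_Un_distrib)
    then have "A \<inter> B = {F. closedin E F \<and> (\<exists>N\<in>?\<N>. F \<inter> N = {})}"
      unfolding *(3,4) by (simp only: Collect_conj_eq[symmetric]) blast
    moreover have "\<forall>N\<in>?\<N>. compactin E N"
      using *(1,2) by (auto intro: compactin_Un)
    ultimately show ?case
      by (intro exI[of _ ?\<N>]) simp
  next
    case (UN \<U>)
    have "\<forall>U\<in>\<U>. ?R U"
      using UN.IH by blast
    from bchoice[OF this] obtain k where k': "\<forall>U\<in>\<U>. (\<forall>K\<in>k U. compactin E K) \<and>
        U = {F. closedin E F \<and> (\<exists>K\<in>k U. F \<inter> K = {})}" ..
    have k: "\<forall>K\<in>k U. compactin E K" if "U \<in> \<U>" for U
      by (rule bspec[OF k' that, THEN conjunct1])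
    have eq: "U = {F. closedin E F \<and> (\<exists>K\<in>k U. F \<inter> K = {})}" if "U \<in> \<U>" for U
      by (rule bspec[OF k' that, THEN conjunct2])
    have "F \<in> U \<longleftrightarrow> closedin E F \<and> (\<exists>K\<in>k U. F \<inter> K = {})" if "U \<in> \<U>" for F U
      using arg_cong[OF eq[OF that], of "\<lambda>S. F \<in> S"] unfolding mem_Collect_eq .
    then have "\<Union>\<U> = {F. closedin E F \<and> (\<exists>K\<in>\<Union>(k ` \<U>). F \<inter> K = {})}"
      by (auto; blast)
    with k show ?case
      by (intro exI[of _ "\<Union>(k ` \<U>)"] conjI) auto
  next
    case (Basis s)
    then obtain K where "compactin E K" "s = {F. closedin E F \<and> F \<inter> K = {}}"
      by blast
    then show ?case
      by (intro exI[of _ "{K}"]) simp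
  qed
next
  assume "?R U"
  then obtain \<K> where \<K>: "\<forall>K\<in>\<K>. compactin E K"
    "U = {F. closedin E F \<and> (\<exists>K\<in>\<K>. F \<inter> K = {})}"
    by blast
  have "openin (upper_Fell_topology E) {F. closedin E F \<and> F \<inter> K = {}}" if "K \<in> \<K>" for K
    using \<K>(1) that unfolding upper_Fell_topology_def
    by (intro topology_generated_by_Basis) blast
  then have "openin (upper_Fell_topology E) (\<Union>K\<in>\<K>. {F. closedin E F \<and> F \<inter> K = {}})"
    by (intro openin_Union) auto
  also have "(\<Union>K\<in>\<K>. {F. closedin E F \<and> F \<inter> K = {}}) = U"
    using \<K>(2) by auto
  finally show "openin (upper_Fell_topology E) U" .
qed

text \<open>
  A compact set disjoint from a closed set \<open>F\<close> is covered by finitely many basic open sets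
  whose closures are compact and still miss \<open>F\<close>. The finite unions of such closures are
  countable in number, and so the upper Fell topology has a countable base.
\<close>

lemma countable_compact_interpolation:
  assumes "locally_compact_space E" and "second_countable E" and "Hausdorff_space E"
  obtains \<C> where "countable \<C>" and "\<And>L. L \<in> \<C> \<Longrightarrow> compactin E L"
    and "\<And>F K. closedin E F \<Longrightarrow> compactin E K \<Longrightarrow> F \<inter> K = {} \<Longrightarrow> \<exists>L\<in>\<C>. K \<subseteq> L \<and> F \<inter> L = {}"
proof -
  obtain \<B> where \<B>: "countable \<B>" "\<forall>V\<in>\<B>. openin E V"
    "\<forall>U x. openin E U \<and> x \<in> U \<longrightarrow> (\<exists>V\<in>\<B>. x \<in> V \<and> V \<subseteq> U)"
    using assms(2) unfolding second_countable_def by (elim exE conjE)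
  have nb: "neighbourhood_base_of (\<lambda>C. compactin E C \<and> closedin E C) E"
    using assms locally_compact_space_neighbourhood_base_closedin by blast
  define \<D> where "\<D> = {E closure_of V | V. V \<in> \<B> \<and> compactin E (E closure_of V)}"
  define \<C> where "\<C> = \<Union> ` {\<F>. finite \<F> \<and> \<F> \<subseteq> \<D>}"
  have "countable \<D>"
    by (rule countable_subset[of _ "(closure_of) E ` \<B>"]) (use \<B>(1) in \<open>auto simp: \<D>_def\<close>)
  then have "countable {\<F>. finite \<F> \<and> \<F> \<subseteq> \<D>}"
    by (rule countable_Collect_finite_subset)
  then have "countable \<C>"
    unfolding \<C>_def by (rule countable_image)
  moreover have "compactin E L" if L_mem: "L \<in> \<C>" for L
  proof -
    obtain \<F> where L: "L = \<Union>\<F>" and \<F>: "\<F> \<in> {\<F>. finite \<F> \<and> \<F> \<subseteq> \<D>}"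
      using L_mem unfolding \<C>_def by (rule imageE)
    have "\<forall>D\<in>\<D>. compactin E D"
      by (auto simp: \<D>_def)
    then have "compactin E D" if "D \<in> \<F>" for D
      using that \<F> by auto
    then show ?thesis
      unfolding L using \<F> by (intro compactin_Union) simp_all
  qed
  moreover have "\<exists>L\<in>\<C>. K \<subseteq> L \<and> F \<inter> L = {}"
    if F: "closedin E F" and K: "compactin E K" and FK: "F \<inter> K = {}" for F K
  proof -
    define \<V> where "\<V> = {V \<in> \<B>. compactin E (E closure_of V) \<and> F \<inter> E closure_of V = {}}"
    have "x \<in> \<Union>\<V>" if "x \<in> K" for x
    proof -
      have "openin E (topspace E - F)" "x \<in> topspace E - F"
        using F K FK that compactin_subset_topspace by (auto simp: openin_diff)
      then have "\<exists>U C. openin E U \<and> (compactin E C \<and> closedin E C) \<and> x \<in> U \<and> U \<subseteq> C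
          \<and> C \<subseteq> topspace E - F"
        using nb unfolding neighbourhood_base_of by simp
      then obtain U C where UC: "openin E U" "compactin E C" "closedin E C" "x \<in> U" "U \<subseteq> C"
        "C \<subseteq> topspace E - F"
        by auto
      have "\<exists>V\<in>\<B>. x \<in> V \<and> V \<subseteq> U"
        using \<B>(3) UC(1,4) by simp
      then obtain V where V: "V \<in> \<B>" "x \<in> V" "V \<subseteq> U"
        by auto
      then have "E closure_of V \<subseteq> C"
        using UC closure_of_minimal[of V C E] by blast
      moreover from this have "compactin E (E closure_of V)"
        using closed_compactin[OF UC(2)] closedin_closure_of by metis
      ultimately have "V \<in> \<V>"
        using V(1) UC(6) unfolding \<V>_def by blast
      with V(2) show ?thesis by blast
    qed
    then have "K \<subseteq> \<Union>\<V>" by (rule subsetI)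
    moreover have "openin E V" if "V \<in> \<V>" for V
      using that \<B>(2) by (simp add: \<V>_def)
    ultimately obtain \<F> where \<F>: "finite \<F>" "\<F> \<subseteq> \<V>" "K \<subseteq> \<Union>\<F>"
      using compactinD[OF K, of \<V>] by auto
    let ?L = "\<Union>((closure_of) E ` \<F>)"
    have "V \<subseteq> E closure_of V" if "V \<in> \<F>" for V
    proof -
      have "openin E V"
        using that \<F>(2) \<B>(2) by (auto simp: \<V>_def)
      then show ?thesis
        by (intro closure_of_subset openin_subset)
    qed
    then have "\<Union>\<F> \<subseteq> ?L" by blast
    with \<F>(3) have "K \<subseteq> ?L" by (rule order.trans)
    moreover have "(closure_of) E ` \<F> \<subseteq> \<D>"
      using \<F>(2) by (auto simp: \<V>_def \<D>_def)
    then have "?L \<in> \<C>"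
      unfolding \<C>_def using \<F>(1) by (intro imageI) simp
    moreover have "F \<inter> ?L = {}"
      using \<F>(2) by (auto simp: \<V>_def)
    ultimately show ?thesis by blast
  qed
  ultimately show ?thesis by (rule that)
qed

text \<open>
  An open set \<open>{F. \<exists>K\<in>\<K>. F \<inter> K = {}}\<close> may come from an uncountable family \<open>\<K>\<close>. Replacing
  the members of \<open>\<K>\<close> by the members of the countable interpolating family that contain one
  of them does not change it, and then a countable union of measurable events remains.
\<close>

lemma measurable_upper_FellI:
  assumes E: "locally_compact_space E" "second_countable E" "Hausdorff_space E"
    and closed: "\<And>\<omega>. \<omega> \<in> space M \<Longrightarrow> closedin E (Y \<omega>)"
    and miss: "\<And>K. compactin E K \<Longrightarrow> {\<omega> \<in> space M. Y \<omega> \<inter> K = {}} \<in> sets M"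
  shows "Y \<in> M \<rightarrow>\<^sub>M borel_of (upper_Fell_topology E)"
proof (rule measurable_borel_ofI)
  show "Y \<omega> \<in> topspace (upper_Fell_topology E)" if "\<omega> \<in> space M" for \<omega>
    using closed that by simp
  fix U assume "openin (upper_Fell_topology E) U"
  then obtain \<K> where \<K>: "\<forall>K\<in>\<K>. compactin E K"
    "U = {F. closedin E F \<and> (\<exists>K\<in>\<K>. F \<inter> K = {})}"
    unfolding openin_upper_Fell_iff by blast
  obtain \<C> where \<C>: "countable \<C>" "\<And>L. L \<in> \<C> \<Longrightarrow> compactin E L"
    "\<And>F K. closedin E F \<Longrightarrow> compactin E K \<Longrightarrow> F \<inter> K = {} \<Longrightarrow> \<exists>L\<in>\<C>. K \<subseteq> L \<and> F \<inter> L = {}"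
    using countable_compact_interpolation[OF E] by blast
  let ?\<L> = "{L \<in> \<C>. \<exists>K\<in>\<K>. K \<subseteq> L}"
  have "{\<omega> \<in> space M. Y \<omega> \<in> U} = (\<Union>L\<in>?\<L>. {\<omega> \<in> space M. Y \<omega> \<inter> L = {}})"
  proof (intro equalityI subsetI)
    fix \<omega> assume "\<omega> \<in> {\<omega> \<in> space M. Y \<omega> \<in> U}"
    then obtain K where "\<omega> \<in> space M" "closedin E (Y \<omega>)" "K \<in> \<K>" "Y \<omega> \<inter> K = {}"
      using \<K>(2) by blast
    moreover from this obtain L where "L \<in> \<C>" "K \<subseteq> L" "Y \<omega> \<inter> L = {}"
      using \<C>(3) \<K>(1) by metis
    ultimately show "\<omega> \<in> (\<Union>L\<in>?\<L>. {\<omega> \<in> space M. Y \<omega> \<inter> L = {}})"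
      by blast
  next
    fix \<omega> assume "\<omega> \<in> (\<Union>L\<in>?\<L>. {\<omega> \<in> space M. Y \<omega> \<inter> L = {}})"
    then obtain L K where "\<omega> \<in> space M" "K \<in> \<K>" "K \<subseteq> L" "Y \<omega> \<inter> L = {}"
      by blast
    then show "\<omega> \<in> {\<omega> \<in> space M. Y \<omega> \<in> U}"
      using closed[of \<omega>] unfolding \<K>(2) by auto
  qed
  also have "\<dots> \<in> sets M"
  proof (rule sets.countable_UN')
    show "countable ?\<L>"
      by (rule countable_subset[OF _ \<C>(1)]) blast
  qed (use \<C>(2) miss in auto)
  finally show "{\<omega> \<in> space M. Y \<omega> \<in> U} \<in> sets M" .
qed

lemma prob_hits_all_plus_prob_misses_some:
  assumes "prob_space N" and X: "X \<in> N \<rightarrow>\<^sub>M borel_of (upper_Fell_topology E)"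
    and \<K>: "\<forall>K\<in>\<K>. compactin E K"
  shows "emeasure N {\<omega> \<in> space N. \<forall>K\<in>\<K>. X \<omega> \<inter> K \<noteq> {}}
    + emeasure N {\<omega> \<in> space N. X \<omega> \<in> {F. closedin E F \<and> (\<exists>K\<in>\<K>. F \<inter> K = {})}} = 1"
    (is "emeasure N ?H + emeasure N ?M = 1")
proof -
  interpret prob_space N by fact
  have meas: "?M \<in> sets N"
    by (rule measurable_borel_of_openin[OF X]) (use \<K> in \<open>auto simp: openin_upper_Fell_iff\<close>)
  have H: "?H = space N - ?M"
    using measurable_space[OF X] by auto
  have "?H \<in> sets N"
    unfolding H using meas by blast
  with meas have "emeasure N ?H + emeasure N ?M = emeasure N (?H \<union> ?M)"
    by (intro plus_emeasure) auto
  also have "?H \<union> ?M = space N"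
    unfolding H by blast
  finally show ?thesis
    by (simp add: emeasure_space_1)
qed

text \<open>
  The portmanteau equivalence of open and closed sets: by the shape of the open sets in
  \<open>openin_upper_Fell_iff\<close>, the closed sets of the upper Fell topology are described by hitting
  all members of a family of compact sets, and the two kinds of probabilities add up to one.
\<close>

lemma converges_in_distribution_upper_Fell_iff:
  assumes dir: "directed_set I le"
    and P: "\<And>i. i \<in> I \<Longrightarrow> prob_space (P i)" and Q: "prob_space Q"
    and Y: "\<And>i. i \<in> I \<Longrightarrow> Y i \<in> P i \<rightarrow>\<^sub>M borel_of (upper_Fell_topology E)"
    and Y': "Y' \<in> Q \<rightarrow>\<^sub>M borel_of (upper_Fell_topology E)"
  shows "converges_in_distribution (upper_Fell_topology E) I le P Y Q Y' \<longleftrightarrow>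
    (\<forall>\<K>. (\<forall>K\<in>\<K>. compactin E K) \<longrightarrow>
       Limsup (net_filter I le)
         (\<lambda>i. emeasure (P i) {\<omega> \<in> space (P i). \<forall>K\<in>\<K>. Y i \<omega> \<inter> K \<noteq> {}})
       \<le> emeasure Q {\<omega> \<in> space Q. \<forall>K\<in>\<K>. Y' \<omega> \<inter> K \<noteq> {}})"
proof -
  let ?M = "\<lambda>\<K>. {F. closedin E F \<and> (\<exists>K\<in>\<K>. F \<inter> K = {})}"
  let ?liminf = "\<lambda>U. emeasure Q {\<omega> \<in> space Q. Y' \<omega> \<in> U}
    \<le> Liminf (net_filter I le) (\<lambda>i. emeasure (P i) {\<omega> \<in> space (P i). Y i \<omega> \<in> U})"
  let ?limsup = "\<lambda>\<K>. Limsup (net_filter I le)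
      (\<lambda>i. emeasure (P i) {\<omega> \<in> space (P i). \<forall>K\<in>\<K>. Y i \<omega> \<inter> K \<noteq> {}})
    \<le> emeasure Q {\<omega> \<in> space Q. \<forall>K\<in>\<K>. Y' \<omega> \<inter> K \<noteq> {}}"
  have "converges_in_distribution (upper_Fell_topology E) I le P Y Q Y' \<longleftrightarrow>
      (\<forall>U. openin (upper_Fell_topology E) U \<longrightarrow> ?liminf U)"
    using Y Y' by (simp add: converges_in_distribution_def)
  also have "\<dots> \<longleftrightarrow> (\<forall>\<K>. (\<forall>K\<in>\<K>. compactin E K) \<longrightarrow> ?liminf (?M \<K>))"
    unfolding openin_upper_Fell_iff by blast
  also have "\<dots> \<longleftrightarrow> (\<forall>\<K>. (\<forall>K\<in>\<K>. compactin E K) \<longrightarrow> ?limsup \<K>)"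
  proof -
    have "?liminf (?M \<K>) \<longleftrightarrow> ?limsup \<K>" if \<K>: "\<forall>K\<in>\<K>. compactin E K" for \<K>
    proof (rule le_Liminf_complement_iff)
      show "\<forall>\<^sub>F i in net_filter I le. emeasure (P i) {\<omega> \<in> space (P i). \<forall>K\<in>\<K>. Y i \<omega> \<inter> K \<noteq> {}}
          + emeasure (P i) {\<omega> \<in> space (P i). Y i \<omega> \<in> ?M \<K>} = 1"
        using eventually_in_net_filter[OF dir]
        by (rule eventually_mono) (rule prob_hits_all_plus_prob_misses_some[OF P Y \<K>])
      show "emeasure Q {\<omega> \<in> space Q. \<forall>K\<in>\<K>. Y' \<omega> \<inter> K \<noteq> {}}
          + emeasure Q {\<omega> \<in> space Q. Y' \<omega> \<in> ?M \<K>} = 1"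
        by (rule prob_hits_all_plus_prob_misses_some[OF Q Y' \<K>])
    qed
    then show ?thesis by blast
  qed
  finally show ?thesis .
qed

section \<open>Continuity of the set of approximate minimisers\<close>

text \<open>
  Lower semicontinuity makes the infimum over a nonempty compact set a minimum: if all values
  exceed \<open>c\<close>, then the open sets \<open>{f > d}\<close> with \<open>d > c\<close> cover \<open>K\<close>, finitely many suffice,
  and the least of the finitely many \<open>d\<close> is a lower bound of \<open>f\<close> on \<open>K\<close>.
\<close>

lemma less_inf_on_compact_iff:
  assumes f: "lower_semicontinuous_map E f" and K: "compactin E K" "K \<noteq> {}"
  shows "c < inf_on K f \<longleftrightarrow> (\<forall>x\<in>K. c < f x)"
proof
  assume "c < inf_on K f"
  then show "\<forall>x\<in>K. c < f x"
    unfolding inf_on_def by (auto dest: less_INF_D)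
next
  assume less: "\<forall>x\<in>K. c < f x"
  let ?V = "\<lambda>d. {x \<in> topspace E. d < f x}"
  have "K \<subseteq> \<Union>(?V ` {c<..})"
  proof
    fix x assume "x \<in> K"
    moreover from this obtain d where "c < d" "d < f x"
      using less dense by blast
    ultimately show "x \<in> \<Union>(?V ` {c<..})"
      using compactin_subset_topspace[OF K(1)] by blast
  qed
  moreover have "openin E V" if "V \<in> ?V ` {c<..}" for V
    using f that unfolding lower_semicontinuous_map_def by blast
  ultimately obtain \<F> where \<F>: "finite \<F>" "\<F> \<subseteq> ?V ` {c<..}" "K \<subseteq> \<Union>\<F>"
    using compactinD[OF K(1), of "?V ` {c<..}"] by auto
  then obtain D where D: "finite D" "D \<subseteq> {c<..}" "\<F> = ?V ` D"
    using finite_subset_image[OF \<F>(1,2)] by blast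
  have "D \<noteq> {}"
    using D(3) \<F>(3) K(2) by blast
  then have "c < Min D"
    using D(1,2) by auto
  also have "Min D \<le> inf_on K f"
    unfolding inf_on_def
  proof (rule INF_greatest)
    fix x assume "x \<in> K"
    then obtain d where "d \<in> D" "d < f x"
      using \<F>(3) D(3) by blast
    then show "Min D \<le> f x"
      using Min_le[OF D(1), of d] by simp
  qed
  finally show "c < inf_on K f" .
qed

lemma eps_optimal_disjoint_iff:
  assumes "f \<in> lsc_functions E" and K: "compactin E K" "K \<noteq> {}"
  shows "eps_optimal E f e \<inter> K = {} \<longleftrightarrow> inf_on (topspace E) f + ereal e < inf_on K f"
proof -
  have f: "lower_semicontinuous_map E f"
    using assms(1) by (simp add: lsc_functions_def)
  have "eps_optimal E f e \<inter> K = {} \<longleftrightarrow> (\<forall>x\<in>K. \<not> f x \<le> inf_on (topspace E) f + ereal e)"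
    using compactin_subset_topspace[OF K(1)] unfolding eps_optimal_def by blast
  also have "\<dots> \<longleftrightarrow> inf_on (topspace E) f + ereal e < inf_on K f"
    unfolding less_inf_on_compact_iff[OF f K] not_le ..
  finally show ?thesis .
qed

lemma closedin_eps_optimal:
  assumes "f \<in> lsc_functions E"
  shows "closedin E (eps_optimal E f e)"
proof -
  have "openin E {x \<in> topspace E. inf_on (topspace E) f + ereal e < f x}"
    using assms by (simp add: lsc_functions_def lower_semicontinuous_map_def)
  moreover have "topspace E - eps_optimal E f e = {x \<in> topspace E. inf_on (topspace E) f + ereal e < f x}"
    by (auto simp: eps_optimal_def)
  ultimately show ?thesis
    by (auto simp: closedin_def eps_optimal_def)
qed

text \<open>
  The infimum \<open>a\<close> of a function may be \<open>-\<infinity>\<close>; the split is into real numbers because the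
  left-order topology needs a real bound for the tolerance.
\<close>

lemma ereal_add_less_split:
  fixes a b :: ereal
  assumes "a + ereal e < b"
  obtains c d :: real where "a < ereal c" and "e < d" and "ereal (c + d) \<le> b"
proof -
  obtain r where r: "a + ereal e < ereal r" "ereal r < b"
    using ereal_dense2[OF assms] by blast
  then have "a < ereal (r - e)"
    by (cases a) auto
  then obtain c where c: "a < ereal c" "ereal c < ereal (r - e)"
    using ereal_dense2 by blast
  show ?thesis
    by (rule that[of c "r - c"]) (use c r(2) in auto)
qed

text \<open>
  The slack in \<open>I\<^sub>E(f) + \<epsilon> < I\<^sub>K(f)\<close> is divided between two reals \<open>c > I\<^sub>E(f)\<close> and
  \<open>d > \<epsilon>\<close>; the first bounds the infimum of neighbouring functions, the second the
  neighbouring tolerances.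
\<close>

lemma continuous_map_eps_optimal:
  "continuous_map (prod_topology (epi_topology E) left_order_topology) (upper_Fell_topology E)
     (\<lambda>(f, e). eps_optimal E f e)"
  (is "continuous_map ?X _ ?g")
  unfolding upper_Fell_topology_def
proof (rule continuous_on_generated_topo)
  show "?g ` topspace ?X \<subseteq> \<Union>{{F. closedin E F \<and> F \<inter> K = {}} | K. compactin E K}"
    using topspace_upper_Fell_topology[of E] closedin_eps_optimal[of _ E]
    unfolding upper_Fell_topology_def topology_generated_by_topspace by auto
next
  fix U assume "U \<in> {{F. closedin E F \<and> F \<inter> K = {}} | K. compactin E K}"
  then obtain K where K: "compactin E K" and U: "U = {F. closedin E F \<and> F \<inter> K = {}}"
    by blast
  let ?W = "{(f, e). f \<in> lsc_functions E \<and> 0 \<le> e \<and> eps_optimal E f e \<inter> K = {}}"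
  have W: "?g -` U \<inter> topspace ?X = ?W"
    using closedin_eps_optimal[of _ E] unfolding U by auto
  show "openin ?X (?g -` U \<inter> topspace ?X)"
  proof (cases "K = {}")
    case True
    then have "?W = topspace ?X"
      by auto
    then show ?thesis unfolding W by (metis openin_topspace)
  next
    case False
    show ?thesis
      unfolding W
    proof (subst openin_prod_topology_alt, intro allI impI)
      fix f e assume "(f, e) \<in> ?W"
      then have f: "f \<in> lsc_functions E" "0 \<le> e" and
        "inf_on (topspace E) f + ereal e < inf_on K f"
        using eps_optimal_disjoint_iff[OF _ K False] by auto
      then obtain r where r: "inf_on (topspace E) f + ereal e < ereal r" "ereal r < inf_on K f"
        using ereal_dense2 by blast
      obtain c d where cd: "inf_on (topspace E) f < ereal c" "e < d" "ereal (c + d) \<le> ereal r"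
        using ereal_add_less_split[OF r(1)] by blast
      let ?A = "{h \<in> lsc_functions E. ereal r < inf_on K h} \<inter>
        {h \<in> lsc_functions E. inf_on (topspace E) h < ereal c}"
      have "openin (epi_topology E) ?A"
        using epi_topology_inf_compact[OF K] epi_topology_inf_open[OF openin_topspace[of E]]
        by (intro openin_Int) (simp_all add: lower_semicontinuous_map_def upper_semicontinuous_map_def)
      moreover have "openin left_order_topology {0..<d}"
        unfolding openin_left_order_topology using cd(2) f(2) by auto
      moreover have "?A \<times> {0..<d} \<subseteq> ?W"
      proof
        fix p assume "p \<in> ?A \<times> {0..<d}"
        then obtain h e' where p: "p = (h, e')" and h: "h \<in> lsc_functions E" "ereal r < inf_on K h"
          "inf_on (topspace E) h < ereal c" and e': "0 \<le> e'" "e' < d"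
          by auto
        have "inf_on (topspace E) h + ereal e' < ereal c + ereal d"
          using h(3) e' by (intro ereal_add_strict_mono2) auto
        also have "\<dots> \<le> ereal r" using cd(3) by simp
        also have "\<dots> < inf_on K h" by fact
        finally show "p \<in> ?W"
          using h(1) e'(1) eps_optimal_disjoint_iff[OF h(1) K False] unfolding p by simp
      qed
      ultimately show "\<exists>A B. openin (epi_topology E) A \<and> openin left_order_topology B \<and>
          f \<in> A \<and> e \<in> B \<and> A \<times> B \<subseteq> ?W"
        using f r cd by (intro exI[of _ ?A] exI[of _ "{0..<d}"]) auto
    qed
  qed
qed

text \<open>
  The functionals \<open>I\<^sub>K\<close> and \<open>I\<^sub>E\<close> are semicontinuous for the epi-topology, hence Borel
  measurable, so the inequality that characterises missing \<open>K\<close> defines a measurable event.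
\<close>

lemma measurable_eps_optimal:
  assumes E: "locally_compact_space E" "second_countable E" "Hausdorff_space E"
    and Z: "normal_integrand E M Z" and e: "e \<in> borel_measurable M"
  shows "(\<lambda>\<omega>. eps_optimal E (Z \<omega>) (e \<omega>)) \<in> M \<rightarrow>\<^sub>M borel_of (upper_Fell_topology E)"
proof (rule measurable_upper_FellI[OF E])
  have Zm: "Z \<in> M \<rightarrow>\<^sub>M borel_of (epi_topology E)"
    using Z by (simp add: normal_integrand_def)
  have lsc: "Z \<omega> \<in> lsc_functions E" if "\<omega> \<in> space M" for \<omega>
    using measurable_space[OF Zm that] by simp
  show "closedin E (eps_optimal E (Z \<omega>) (e \<omega>))" if "\<omega> \<in> space M" for \<omega>
    using lsc[OF that] by (rule closedin_eps_optimal)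
  fix K assume K: "compactin E K"
  have [measurable]: "(\<lambda>\<omega>. inf_on K (Z \<omega>)) \<in> borel_measurable M"
  proof (rule borel_measurableI_greater)
    fix y
    have "openin (epi_topology E) {f \<in> lsc_functions E. y < inf_on K f}"
      using epi_topology_inf_compact[OF K] by (simp add: lower_semicontinuous_map_def)
    from measurable_borel_of_openin[OF Zm this]
    have "{\<omega> \<in> space M. Z \<omega> \<in> lsc_functions E \<and> y < inf_on K (Z \<omega>)} \<in> sets M"
      by simp
    also have "{\<omega> \<in> space M. Z \<omega> \<in> lsc_functions E \<and> y < inf_on K (Z \<omega>)} = {\<omega> \<in> space M. y < inf_on K (Z \<omega>)}"
      using lsc by blast
    finally show "{\<omega> \<in> space M. y < inf_on K (Z \<omega>)} \<in> sets M" .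
  qed
  have [measurable]: "(\<lambda>\<omega>. inf_on (topspace E) (Z \<omega>)) \<in> borel_measurable M"
  proof (rule borel_measurableI_less)
    fix y
    have "openin (epi_topology E) {f \<in> lsc_functions E. inf_on (topspace E) f < y}"
      using epi_topology_inf_open[OF openin_topspace, of E] by (simp add: upper_semicontinuous_map_def)
    from measurable_borel_of_openin[OF Zm this]
    have "{\<omega> \<in> space M. Z \<omega> \<in> lsc_functions E \<and> inf_on (topspace E) (Z \<omega>) < y} \<in> sets M"
      by simp
    also have "{\<omega> \<in> space M. Z \<omega> \<in> lsc_functions E \<and> inf_on (topspace E) (Z \<omega>) < y} = {\<omega> \<in> space M. inf_on (topspace E) (Z \<omega>) < y}"
      using lsc by blast
    finally show "{\<omega> \<in> space M. inf_on (topspace E) (Z \<omega>) < y} \<in> sets M" .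
  qed
  note e[measurable]
  show "{\<omega> \<in> space M. eps_optimal E (Z \<omega>) (e \<omega>) \<inter> K = {}} \<in> sets M"
  proof (cases "K = {}")
    case False
    have "{\<omega> \<in> space M. eps_optimal E (Z \<omega>) (e \<omega>) \<inter> K = {}} =
        {\<omega> \<in> space M. inf_on (topspace E) (Z \<omega>) + ereal (e \<omega>) < inf_on K (Z \<omega>)}"
      by (rule Collect_cong) (use eps_optimal_disjoint_iff[OF lsc K False] in metis)
    also have "\<dots> \<in> sets M"
      by measurable
    finally show ?thesis .
  qed simp
qed

theorem theorem5:
  fixes E :: "'a topology"
    and I :: "'i set" and le :: "'i \<Rightarrow> 'i \<Rightarrow> bool"
    and P :: "'i \<Rightarrow> 'w measure" and Z :: "'i \<Rightarrow> 'w \<Rightarrow> 'a \<Rightarrow> ereal" and \<epsilon> :: "'i \<Rightarrow> 'w \<Rightarrow> real"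
    and Q :: "'v measure" and Z' :: "'v \<Rightarrow> 'a \<Rightarrow> ereal" and \<epsilon>' :: "'v \<Rightarrow> real"
  assumes "locally_compact_space E" and "second_countable E" and "Hausdorff_space E"
    and "directed_set I le"
    and "\<And>\<alpha>. \<alpha> \<in> I \<Longrightarrow> prob_space (P \<alpha>)"
    and "\<And>\<alpha>. \<alpha> \<in> I \<Longrightarrow> normal_integrand E (P \<alpha>) (Z \<alpha>)"
    and "\<And>\<alpha>. \<alpha> \<in> I \<Longrightarrow> \<epsilon> \<alpha> \<in> borel_measurable (P \<alpha>)"
    and "\<And>\<alpha> \<omega>. \<alpha> \<in> I \<Longrightarrow> \<omega> \<in> space (P \<alpha>) \<Longrightarrow> 0 \<le> \<epsilon> \<alpha> \<omega>"
    and "prob_space Q"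
    and "normal_integrand E Q Z'"
    and "\<epsilon>' \<in> borel_measurable Q"
    and "\<And>\<omega>. \<omega> \<in> space Q \<Longrightarrow> 0 \<le> \<epsilon>' \<omega>"
  shows
    "(converges_in_distribution (prod_topology (epi_topology E) left_order_topology) I le
        P (\<lambda>\<alpha> \<omega>. (Z \<alpha> \<omega>, \<epsilon> \<alpha> \<omega>)) Q (\<lambda>\<omega>. (Z' \<omega>, \<epsilon>' \<omega>)) \<longrightarrow>
      converges_in_distribution (upper_Fell_topology E) I le
        P (\<lambda>\<alpha> \<omega>. eps_optimal E (Z \<alpha> \<omega>) (\<epsilon> \<alpha> \<omega>)) Q (\<lambda>\<omega>. eps_optimal E (Z' \<omega>) (\<epsilon>' \<omega>)))
     \<and>
     (converges_in_distribution (upper_Fell_topology E) I le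
        P (\<lambda>\<alpha> \<omega>. eps_optimal E (Z \<alpha> \<omega>) (\<epsilon> \<alpha> \<omega>)) Q (\<lambda>\<omega>. eps_optimal E (Z' \<omega>) (\<epsilon>' \<omega>)) \<longleftrightarrow>
      (\<forall>\<K>. (\<forall>K\<in>\<K>. compactin E K) \<longrightarrow>
         Limsup (net_filter I le)
           (\<lambda>\<alpha>. emeasure (P \<alpha>)
              {\<omega> \<in> space (P \<alpha>). \<forall>K\<in>\<K>. eps_optimal E (Z \<alpha> \<omega>) (\<epsilon> \<alpha> \<omega>) \<inter> K \<noteq> {}})
         \<le> emeasure Q
              {\<omega> \<in> space Q. \<forall>K\<in>\<K>. eps_optimal E (Z' \<omega>) (\<epsilon>' \<omega>) \<inter> K \<noteq> {}}))"
proof (rule conjI, rule impI)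
  assume "converges_in_distribution (prod_topology (epi_topology E) left_order_topology) I le
    P (\<lambda>\<alpha> \<omega>. (Z \<alpha> \<omega>, \<epsilon> \<alpha> \<omega>)) Q (\<lambda>\<omega>. (Z' \<omega>, \<epsilon>' \<omega>))"
  from converges_in_distribution_continuous_map[OF assms(4) continuous_map_eps_optimal this]
  show "converges_in_distribution (upper_Fell_topology E) I le
    P (\<lambda>\<alpha> \<omega>. eps_optimal E (Z \<alpha> \<omega>) (\<epsilon> \<alpha> \<omega>)) Q (\<lambda>\<omega>. eps_optimal E (Z' \<omega>) (\<epsilon>' \<omega>))"
    by simp
next
  show "converges_in_distribution (upper_Fell_topology E) I le
      P (\<lambda>\<alpha> \<omega>. eps_optimal E (Z \<alpha> \<omega>) (\<epsilon> \<alpha> \<omega>)) Q (\<lambda>\<omega>. eps_optimal E (Z' \<omega>) (\<epsilon>' \<omega>)) \<longleftrightarrow>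
    (\<forall>\<K>. (\<forall>K\<in>\<K>. compactin E K) \<longrightarrow>
       Limsup (net_filter I le)
         (\<lambda>\<alpha>. emeasure (P \<alpha>)
            {\<omega> \<in> space (P \<alpha>). \<forall>K\<in>\<K>. eps_optimal E (Z \<alpha> \<omega>) (\<epsilon> \<alpha> \<omega>) \<inter> K \<noteq> {}})
       \<le> emeasure Q
            {\<omega> \<in> space Q. \<forall>K\<in>\<K>. eps_optimal E (Z' \<omega>) (\<epsilon>' \<omega>) \<inter> K \<noteq> {}})"
    by (rule converges_in_distribution_upper_Fell_iff[OF assms(4) assms(5) assms(9)
          measurable_eps_optimal[OF assms(1-3) assms(6) assms(7)]
          measurable_eps_optimal[OF assms(1-3) assms(10) assms(11)]])
qed

end
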